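(* Let $S$ be a non-empty set and let $\mathscr{A}$ be a $C^*$-algebra. (i) Let $K:S\times S\to\mathscr{A}$ be a conditionally positive definite kernel. Then $2\,\mathrm{Re}\, K(s,t) \leq K(s,s)+K(t,t)$ for all $s, t\in S$. (ii) Let $L:S\times S\to\mathscr{A}$ be a positive definite kernel. Then $L(s,t)L(t,s) \leq \|L(t,t)\|\, L(s,s)$ for all $s, t\in S$.
   Context: A kernel $L:S\times S\to\mathscr{A}$ is hermitian if $L(t,s)^*=L(s,t)$ for all $s,t\in S$. A hermitian kernel $L$ is positive definite if $\sum_{i,j=1}^n a_i^*L(s_i,s_j)a_j\geq 0$ for every positive integer $n$, all $s_1,\dots,s_n\in S$ and all $a_1,\dots,a_n\in\mathscr{A}$. A hermitian kernel $K$ is conditionally positive definite if $\sum_{i,j=1}^n a_i^*K(s_i,s_j)a_j\geq 0$ for all integers $n\geq 2$, all $s_1,\dots,s_n\in S$ and all $a_1,\dots,a_n\in\mathscr{A}$ with $\sum_{i=1}^n a_i=0$. For $a\in\mathscr{A}$, $\mathrm{Re}\,a=\frac12(a+a^* )$. *)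

theory Defs
  imports Complex_Main
begin

text \<open>
  A complex Banach algebra, not necessarily unital. The real normed algebra structure of the
  library is kept and extended by a compatible complex scalar multiplication.
\<close>

class complex_banach_algebra = real_normed_algebra + banach +
  fixes scaleC :: "complex \<Rightarrow> 'a \<Rightarrow> 'a"  (infixr \<open>*\<^sub>C\<close> 75)
  assumes scaleC_add_right: "z *\<^sub>C (a + b) = z *\<^sub>C a + z *\<^sub>C b"
    and scaleC_add_left: "(z + w) *\<^sub>C a = z *\<^sub>C a + w *\<^sub>C a"
    and scaleC_scaleC: "z *\<^sub>C w *\<^sub>C a = (z * w) *\<^sub>C a"
    and scaleC_of_real: "complex_of_real r *\<^sub>C a = r *\<^sub>R a"
    and mult_scaleC_left: "(z *\<^sub>C a) * b = z *\<^sub>C (a * b)"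
    and mult_scaleC_right: "a * (z *\<^sub>C b) = z *\<^sub>C (a * b)"
    and norm_scaleC: "norm (z *\<^sub>C a) = cmod z * norm a"

class cstar_algebra = complex_banach_algebra +
  fixes adj :: "'a \<Rightarrow> 'a"  (\<open>_\<^sup>\<star>\<close> [1000] 999)
  assumes adj_adj: "(a\<^sup>\<star>)\<^sup>\<star> = a"
    and adj_add: "(a + b)\<^sup>\<star> = a\<^sup>\<star> + b\<^sup>\<star>"
    and adj_scaleC: "(z *\<^sub>C a)\<^sup>\<star> = cnj z *\<^sub>C a\<^sup>\<star>"
    and adj_mult: "(a * b)\<^sup>\<star> = b\<^sup>\<star> * a\<^sup>\<star>"
    and cstar_identity: "norm (a\<^sup>\<star> * a) = (norm a)\<^sup>2"

text \<open>
  The pair \<open>(a, z)\<close> stands for the element \<open>a + z 1\<close> of the algebra with a unit adjoined; the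
  unit is \<open>(0, 1)\<close>. The spectrum is taken in this unitization, so that it makes sense without
  a unit. If the algebra already has a unit, this is the usual spectrum with the point 0 added,
  which does not affect whether the spectrum lies in the nonnegative half-line.
\<close>

fun unitization_mult :: "'a::complex_banach_algebra \<times> complex \<Rightarrow> 'a \<times> complex \<Rightarrow> 'a \<times> complex"
  where "unitization_mult (a, z) (b, w) = (a * b + z *\<^sub>C b + w *\<^sub>C a, z * w)"

definition spectrum :: "'a::complex_banach_algebra \<Rightarrow> complex set"
  where "spectrum a = {z. \<not> (\<exists>y. unitization_mult (a, - z) y = (0, 1) \<and>
                                unitization_mult y (a, - z) = (0, 1))}"

definition cstar_positive :: "'a::cstar_algebra \<Rightarrow> bool"
  where "cstar_positive a \<longleftrightarrow> a\<^sup>\<star> = a \<and> spectrum a \<subseteq> complex_of_real ` {0..}"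

definition cstar_le :: "'a::cstar_algebra \<Rightarrow> 'a \<Rightarrow> bool"  (infix \<open>\<preceq>\<close> 50)
  where "a \<preceq> b \<longleftrightarrow> cstar_positive (b - a)"

definition cstar_Re :: "'a::cstar_algebra \<Rightarrow> 'a"
  where "cstar_Re a = (1 / 2) *\<^sub>R (a + a\<^sup>\<star>)"

text \<open>Kernels are total functions of which only the values on \<open>S \<times> S\<close> matter.\<close>

definition hermitian_kernel :: "'s set \<Rightarrow> ('s \<Rightarrow> 's \<Rightarrow> 'a::cstar_algebra) \<Rightarrow> bool"
  where "hermitian_kernel S L \<longleftrightarrow> (\<forall>s\<in>S. \<forall>t\<in>S. (L t s)\<^sup>\<star> = L s t)"

definition positive_definite_kernel :: "'s set \<Rightarrow> ('s \<Rightarrow> 's \<Rightarrow> 'a::cstar_algebra) \<Rightarrow> bool"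
  where "positive_definite_kernel S L \<longleftrightarrow> hermitian_kernel S L \<and>
    (\<forall>n\<ge>1. \<forall>(s :: nat \<Rightarrow> 's) (a :: nat \<Rightarrow> 'a). (\<forall>i\<in>{1..n}. s i \<in> S) \<longrightarrow>
       0 \<preceq> (\<Sum>i=1..n. \<Sum>j=1..n. (a i)\<^sup>\<star> * L (s i) (s j) * a j))"

definition conditionally_positive_definite_kernel ::
    "'s set \<Rightarrow> ('s \<Rightarrow> 's \<Rightarrow> 'a::cstar_algebra) \<Rightarrow> bool"
  where "conditionally_positive_definite_kernel S K \<longleftrightarrow> hermitian_kernel S K \<and>
    (\<forall>n\<ge>2. \<forall>(s :: nat \<Rightarrow> 's) (a :: nat \<Rightarrow> 'a).
       (\<forall>i\<in>{1..n}. s i \<in> S) \<longrightarrow> (\<Sum>i=1..n. a i) = 0 \<longrightarrow>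
       0 \<preceq> (\<Sum>i=1..n. \<Sum>j=1..n. (a i)\<^sup>\<star> * K (s i) (s j) * a j))"

end

theory Submission
  imports Defs "HOL-Analysis.Analysis"
begin

text \<open>
  Both parts reduce to the fact that a selfadjoint \<open>b\<close> with \<open>b * b * b\<close> positive is itself positive
  (\<open>cstar_positive_if_cube\<close>): the spectrum of \<open>b\<close> is real, and a negative spectral value of \<open>b\<close>
  would give a negative one of \<open>b * b * b\<close>. So if \<open>a\<^sup>\<star> * b * a\<close> is positive for all \<open>a\<close>, the
  single choice \<open>a = b\<close> shows that \<open>b\<close> is positive.

  For (i), the coefficients \<open>b\<close> and \<open>- b\<close> at the points \<open>s\<close> and \<open>t\<close>, with
  \<open>b = K s s + K t t - K s t - K t s\<close>, turn conditional positive definiteness into positivity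
  of \<open>b * b * b\<close>.

  For (ii), write \<open>q = L t t\<close>, \<open>x = L s t\<close>, and let \<open>Q > norm q\<close>. The coefficients \<open>a\<close> and
  \<open>- x\<^sup>\<star> a / Q\<close> would leave a remainder with \<open>x q x\<^sup>\<star>\<close>, to be estimated by \<open>Q x x\<^sup>\<star>\<close>. A better
  second coefficient makes an identity of this estimate: it is \<open>- u x\<^sup>\<star> a / Q\<close>, where \<open>u\<close> lies in
  the unitization, is selfadjoint, commutes with \<open>w = q / Q\<close> and solves \<open>2 u - w u\<^sup>2 = 1\<close>, that is
  \<open>u = (1 - sqrt (1 - w)) / w\<close>. What remains is exactly \<open>a\<^sup>\<star> (L s s - x x\<^sup>\<star> / Q) a\<close>, and the cube
  argument applies (\<open>positive_definite_schur_complement\<close>). Since \<open>norm w < 1\<close>, such a \<open>u\<close> is found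
  as the fixed point of a contraction (\<open>exists_square_root_solution\<close>).

  It remains to let \<open>Q\<close> tend to \<open>norm q\<close>, which needs that the set of positive elements is closed
  (\<open>cstar_positive_closed\<close>). This rests on the equality of norm and spectral radius for
  selfadjoint elements, in the form \<open>exists_not_quasi_invertible_on_circle\<close>: it bounds the
  inverses of \<open>1 + \<mu> b\<close> uniformly over all positive \<open>b\<close>, so invertibility survives a limit.

  The spectrum lives in the unitization, but everything can be said inside the algebra by
  quasi-inverses: \<open>1 - a\<close> has inverse \<open>1 - b\<close> iff \<open>a + b = a * b = b * a\<close>.
\<close>

section \<open>Quasi-inverses\<close>

definition quasi_inverse :: "'a::ring \<Rightarrow> 'a \<Rightarrow> bool"
  where "quasi_inverse a b \<longleftrightarrow> a + b = a * b \<and> a + b = b * a"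

lemma quasi_inverse_sym: "quasi_inverse a b \<Longrightarrow> quasi_inverse b a"
  unfolding quasi_inverse_def by (metis add.commute)

lemma left_right_quasi_inverse_eq:
  fixes a :: "'a::ring"
  assumes "a + b = a * b" "a + c = c * a"
  shows "b = c"
proof -
  have "c * a + c * b = c * (a * b)"
    using assms(1) by (metis distrib_left)
  also have "\<dots> = a * b + c * b"
    using assms(2) by (metis mult.assoc distrib_right)
  finally show ?thesis
    using assms by (metis add_right_cancel add_left_cancel)
qed

lemma quasi_inverseI:
  fixes a :: "'a::ring"
  assumes "a + b = a * b" "a + c = c * a"
  shows "quasi_inverse a b"
  using assms left_right_quasi_inverse_eq[OF assms] by (simp add: quasi_inverse_def)

lemma quasi_inverse_unique:
  "quasi_inverse a b \<Longrightarrow> quasi_inverse a c \<Longrightarrow> b = c"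
  unfolding quasi_inverse_def using left_right_quasi_inverse_eq by blast

text \<open>
  In the unitization this is \<open>((1 - a) * (1 - b))\<inverse> = (1 - b') * (1 - a')\<close>.
\<close>

lemma quasi_inverse_comp:
  fixes a b :: "'a::ring"
  assumes "quasi_inverse a a'" "quasi_inverse b b'"
  shows "quasi_inverse (a + b - a * b) (b' + a' - b' * a')"
proof -
  have a: "a * a' = a + a'" "a' * a = a + a'" and b: "b * b' = b + b'" "b' * b = b + b'"
    using assms by (auto simp: quasi_inverse_def)
  have a3: "a * (a' * z) = a * z + a' * z" "a' * (a * z) = a * z + a' * z"
    and b3: "b * (b' * z) = b * z + b' * z" "b' * (b * z) = b * z + b' * z" for z
    using a b by (metis mult.assoc distrib_right)+
  show ?thesis
    by (simp add: quasi_inverse_def algebra_simps a b a3 b3)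
qed

text \<open>
  The partial fraction \<open>(1 - x\<^sup>2)\<inverse> = ((1 - x)\<inverse> + (1 + x)\<inverse>) / 2\<close>. Averaging does not
  increase distances, which makes estimates of resolvents pass from \<open>x\<close> to \<open>x\<^sup>2\<close> unchanged.
\<close>

lemma quasi_inverse_square:
  fixes x :: "'a::real_algebra"
  assumes "quasi_inverse x g" "quasi_inverse (- x) g'"
  shows "quasi_inverse (x * x) ((1/2) *\<^sub>R (g + g'))"
proof -
  have g: "x * g = x + g" "g * x = x + g" and g': "x * g' = x - g'" "g' * x = x - g'"
    using assms by (auto simp: quasi_inverse_def algebra_simps)
  have "x * x * g = x * x + x + g" "x * x * g' = x * x - x + g'"
    by (simp_all add: mult.assoc g g' algebra_simps)
  moreover have "g * (x * x) = x * x + x + g" "g' * (x * x) = x * x - x + g'"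
    by (simp_all add: mult.assoc[symmetric] g g' algebra_simps)
  ultimately show ?thesis
    by (simp add: quasi_inverse_def distrib_left distrib_right flip: scaleR_right_distrib)
      (simp add: scaleR_right_distrib flip: scaleR_left_distrib)
qed

text \<open>
  From \<open>1 - x\<^sup>3 = (1 - x) (1 + x + x\<^sup>2)\<close>, an inverse of \<open>1 - x\<close> is \<open>(1 + x + x\<^sup>2) (1 - g)\<close>.
\<close>

lemma quasi_invertible_if_cube:
  fixes x :: "'a::ring"
  assumes "quasi_inverse (x * x * x) g"
  shows "\<exists>h. quasi_inverse x h"
proof -
  have g: "x * (x * (x * g)) = x * (x * x) + g" "g * (x * (x * x)) = x * (x * x) + g"
    using assms by (auto simp: quasi_inverse_def mult.assoc)
  have g3: "g * (x * (x * (x * z))) = x * (x * (x * z)) + g * z" for z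
    using g(2) by (metis mult.assoc distrib_right)
  have "quasi_inverse x (g - x - x * x + x * g + x * x * g)"
    by (rule quasi_inverseI[where c = "g - x - x * x + g * x + g * x * x"])
      (simp_all add: algebra_simps g g3)
  then show ?thesis ..
qed

section \<open>Quasi-inverses in Banach algebras\<close>

lemma norm_quasi_inverse_le:
  fixes a :: "'a::real_normed_algebra"
  assumes "quasi_inverse a b" "norm a < 1"
  shows "norm b \<le> norm a / (1 - norm a)"
proof -
  have "b = a * b - a"
    using assms(1) by (simp add: quasi_inverse_def algebra_simps)
  then have "norm b \<le> norm a * norm b + norm a"
    by (metis norm_mult_ineq norm_triangle_ineq4 add_right_mono order_trans)
  then show ?thesis
    using assms(2) by (simp add: field_simps)
qed

lemma contraction_fixpoint:
  fixes T :: "'a::banach \<Rightarrow> 'a"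
  assumes "\<theta> < 1" "\<And>c d. norm (T c - T d) \<le> \<theta> * norm (c - d)"
  shows "\<exists>c. T c = c"
proof -
  have "\<exists>!c. T c = c"
  proof (rule banach_fix_type[where c = "max 0 \<theta>"])
    show "\<forall>x y. dist (T x) (T y) \<le> max 0 \<theta> * dist x y"
      by (metis assms(2) dist_norm max.cobounded2 mult_right_mono norm_ge_zero order_trans)
  qed (use assms in auto)
  then show ?thesis by blast
qed

lemma quasi_invertible_if_norm_less_1:
  fixes a :: "'a::{real_normed_algebra,banach}"
  assumes "norm a < 1"
  shows "\<exists>b. quasi_inverse a b"
proof -
  obtain b where "a * b - a = b"
    using contraction_fixpoint[of "norm a" "\<lambda>b. a * b - a"] assms
    by (auto simp: norm_mult_ineq simp flip: right_diff_distrib)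
  moreover obtain c where "c * a - a = c"
    using contraction_fixpoint[of "norm a" "\<lambda>b. b * a - a"] assms
    by (auto simp: norm_mult_ineq mult.commute[of "norm a"] simp flip: left_diff_distrib)
  ultimately have "quasi_inverse a b"
    by (intro quasi_inverseI[where c = c]) (auto simp: algebra_simps)
  then show ?thesis ..
qed

text \<open>
  Openness of the invertible elements, with constants: \<open>C\<close> bounds the norm of the inverse
  \<open>1 - b\<close>, and the change of the inverse is linear in \<open>c\<close> with a factor that depends on \<open>C\<close> only.
\<close>

lemma quasi_inverse_perturb:
  fixes a :: "'a::{real_normed_algebra,banach}"
  assumes ab: "quasi_inverse a b" and C: "1 + norm b \<le> C" and c: "norm c * C \<le> 1/2"
  shows "\<exists>g. quasi_inverse (a + c) g \<and> norm (g - b) \<le> 2 * norm c * C\<^sup>2"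
proof -
  define e where "e = c - b * c"
  have "norm e \<le> norm c * (1 + norm b)"
    unfolding e_def using norm_triangle_ineq4[of c "b * c"] norm_mult_ineq[of b c]
    by (simp add: algebra_simps)
  also have "\<dots> \<le> norm c * C"
    using C by (intro mult_left_mono) auto
  finally have e: "norm e \<le> norm c * C" "norm e \<le> 1/2"
    using c by auto
  obtain d where d: "quasi_inverse e d"
    using quasi_invertible_if_norm_less_1[of e] e by auto
  (* Here 1 - (a + c) = (1 - a) * (1 - e), and 1 - d is the inverse of 1 - e. *)
  have "norm d \<le> norm e / (1 - norm e)"
    using norm_quasi_inverse_le[OF d] e by auto
  also have "\<dots> \<le> norm e / (1/2)"
    using e by (intro divide_left_mono) auto
  finally have "norm d \<le> 2 * (norm c * C)"
    using e by simp
  moreover have "norm (d - d * b) \<le> norm d * (1 + norm b)"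
    using norm_triangle_ineq4[of d "d * b"] norm_mult_ineq[of d b]
    by (simp add: algebra_simps)
  moreover have "norm d * (1 + norm b) \<le> norm d * C"
    using C by (intro mult_left_mono) auto
  moreover have "0 \<le> C"
    using C norm_ge_zero[of b] by linarith
  ultimately have "norm (d + b - d * b - b) \<le> 2 * (norm c * C) * C"
    by (smt (verit) mult_right_mono add_diff_cancel_left' add.commute add_diff_eq diff_diff_eq)
  moreover have "a + e - a * e = a + c"
  proof -
    have "a * (b * c) = a * c + b * c"
      using ab by (metis quasi_inverse_def mult.assoc distrib_right)
    then show ?thesis
      by (simp add: e_def algebra_simps)
  qed
  then have "quasi_inverse (a + c) (d + b - d * b)"
    using quasi_inverse_comp[OF ab d] by metis
  ultimately show ?thesis
    by (intro exI[of _ "d + b - d * b"]) (simp add: power2_eq_square mult.assoc)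
qed

section \<open>Scalar multiplication, adjoint and spectrum\<close>

lemma scaleC_zero_right [simp]: "z *\<^sub>C (0::'a::complex_banach_algebra) = 0"
  using scaleC_add_right[of z 0 "0::'a"] by simp

lemma scaleC_minus_right: "z *\<^sub>C (- a) = - (z *\<^sub>C (a::'a::complex_banach_algebra))"
  using scaleC_add_right[of z a "- a"] by (simp add: add_eq_0_iff2)

lemma scaleC_diff_right: "z *\<^sub>C (a - b) = z *\<^sub>C a - z *\<^sub>C (b::'a::complex_banach_algebra)"
  using scaleC_add_right[of z a "- b"] by (simp add: scaleC_minus_right)

lemma scaleC_one [simp]: "1 *\<^sub>C (a::'a::complex_banach_algebra) = a"
  using scaleC_of_real[of 1 a] by simp

lemma scaleC_zero_left [simp]: "0 *\<^sub>C (a::'a::complex_banach_algebra) = 0"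
  using scaleC_of_real[of 0 a] by simp

lemma scaleC_minus_left: "(- z) *\<^sub>C a = - (z *\<^sub>C (a::'a::complex_banach_algebra))"
  using scaleC_add_left[of z "- z" a] by (simp add: add_eq_0_iff)

lemma scaleC_diff_left: "(z - w) *\<^sub>C a = z *\<^sub>C a - w *\<^sub>C (a::'a::complex_banach_algebra)"
  using scaleC_add_left[of z "- w" a] by (simp add: scaleC_minus_left)

lemmas scaleC_simps = scaleC_add_right scaleC_diff_right scaleC_minus_right
  scaleC_scaleC mult_scaleC_left mult_scaleC_right

lemma adj_scaleR: "(r *\<^sub>R a)\<^sup>\<star> = r *\<^sub>R (a::'a::cstar_algebra)\<^sup>\<star>"
  using adj_scaleC[of "complex_of_real r" a] by (simp add: scaleC_of_real)

lemma adj_minus: "(- a)\<^sup>\<star> = - (a::'a::cstar_algebra)\<^sup>\<star>"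
  using adj_scaleR[of "- 1" a] by simp

lemma adj_diff: "(a - b)\<^sup>\<star> = a\<^sup>\<star> - (b::'a::cstar_algebra)\<^sup>\<star>"
  using adj_add[of a "- b"] by (simp add: adj_minus)

lemmas adj_simps = adj_adj adj_add adj_diff adj_minus adj_scaleR adj_scaleC adj_mult

lemma norm_adj: "norm (a\<^sup>\<star>) = norm (a::'a::cstar_algebra)"
proof -
  have le: "norm b \<le> norm (b\<^sup>\<star>)" for b :: 'a
  proof (cases "b = 0")
    case False
    have "norm b * norm b \<le> norm (b\<^sup>\<star>) * norm b"
      using norm_mult_ineq[of "b\<^sup>\<star>" b] by (simp add: cstar_identity power2_eq_square)
    then show ?thesis
      using False by simp
  qed simp
  show ?thesis
    using le[of a] le[of "a\<^sup>\<star>"] by (simp add: adj_adj)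
qed

lemma quasi_inverse_adj:
  fixes a :: "'a::cstar_algebra"
  assumes "quasi_inverse a b"
  shows "quasi_inverse (a\<^sup>\<star>) (b\<^sup>\<star>)"
  using assms unfolding quasi_inverse_def by (metis adj_add adj_mult)

text \<open>
  For \<open>z \<noteq> 0\<close> the element \<open>a - z\<close> of the unitization is \<open>- z (1 - a / z)\<close>.
\<close>

lemma spectrum_compl_iff:
  fixes a :: "'a::complex_banach_algebra"
  assumes "z \<noteq> 0"
  shows "z \<notin> spectrum a \<longleftrightarrow> (\<exists>g. quasi_inverse ((1 / z) *\<^sub>C a) g)"
proof
  assume "z \<notin> spectrum a"
  then obtain y w where "unitization_mult (a, - z) (y, w) = (0, 1)"
      "unitization_mult (y, w) (a, - z) = (0, 1)"
    by (force simp: spectrum_def)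
  then have zw: "- (z * w) = 1"
      and y: "a * y - z *\<^sub>C y + w *\<^sub>C a = 0" "y * a - z *\<^sub>C y + w *\<^sub>C a = 0"
    by (auto simp: scaleC_minus_left algebra_simps)
  from zw have w: "z * w = - 1"
    by (metis minus_minus)
  have "w = (z * w) / z"
    using assms by simp
  then have "w = - (1 / z)"
    by (simp only: w minus_divide_left)
  then have "a * y = (1 / z) *\<^sub>C a + z *\<^sub>C y" "y * a = (1 / z) *\<^sub>C a + z *\<^sub>C y"
    using y by (simp_all only: scaleC_minus_left) (simp_all add: algebra_simps)
  then have "quasi_inverse ((1 / z) *\<^sub>C a) (z *\<^sub>C y)"
    using assms by (simp add: quasi_inverse_def scaleC_scaleC mult_scaleC_left mult_scaleC_right)
  then show "\<exists>g. quasi_inverse ((1 / z) *\<^sub>C a) g" ..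
next
  assume "\<exists>g. quasi_inverse ((1 / z) *\<^sub>C a) g"
  then obtain g where g: "(1 / z) *\<^sub>C a + g = (1 / z) *\<^sub>C (a * g)" "(1 / z) *\<^sub>C a + g = (1 / z) *\<^sub>C (g * a)"
    by (auto simp: quasi_inverse_def scaleC_simps)
  have "unitization_mult (a, - z) ((1 / z) *\<^sub>C g, - (1 / z)) = (0, 1)"
      "unitization_mult ((1 / z) *\<^sub>C g, - (1 / z)) (a, - z) = (0, 1)"
    using assms
    by (simp_all add: mult_scaleC_left mult_scaleC_right scaleC_minus_left scaleC_scaleC flip: g)
  then show "z \<notin> spectrum a"
    unfolding spectrum_def by blast
qed

section \<open>Selfadjoint elements have real spectrum\<close>

text \<open>
  The classical argument: for real \<open>t\<close>, multiplication by \<open>h + \<i> t\<close> has norm at most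
  \<open>sqrt ((norm h)\<^sup>2 + t\<^sup>2)\<close> by the \<open>C\<^sup>*\<close>-identity, and for suitable \<open>t\<close> this is less than
  \<open>cmod (z + \<i> t)\<close>. The equation for \<open>c\<close> says \<open>(z + \<i> t) c = (h + \<i> t) c - h\<close> and so is solved
  by a contraction.
\<close>

lemma right_quasi_inverse_nonreal:
  fixes h :: "'a::cstar_algebra"
  assumes h: "h\<^sup>\<star> = h" and z: "Im z \<noteq> 0"
  shows "\<exists>c. h + z *\<^sub>C c = h * c"
proof -
  (* With this t the mixed term 2 * Im z * t of the squared modulus of z + i t is (norm h)^2. *)
  define t where "t = (norm h)\<^sup>2 / (2 * Im z)"
  define \<nu> where "\<nu> = z + \<i> * complex_of_real t"
  have "(cmod \<nu>)\<^sup>2 = (Re z)\<^sup>2 + (Im z)\<^sup>2 + (norm h)\<^sup>2 + t\<^sup>2"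
    using z by (simp add: \<nu>_def t_def cmod_power2 power2_sum)
  moreover have "(Im z)\<^sup>2 > 0"
    using z by simp
  ultimately have less: "(norm h)\<^sup>2 + t\<^sup>2 < (cmod \<nu>)\<^sup>2"
    using zero_le_power2[of "Re z"] by linarith
  define \<theta> where "\<theta> = sqrt ((norm h)\<^sup>2 + t\<^sup>2) / cmod \<nu>"
  have sless: "sqrt ((norm h)\<^sup>2 + t\<^sup>2) < cmod \<nu>"
    using less by (simp add: real_less_lsqrt)
  moreover have "0 \<le> sqrt ((norm h)\<^sup>2 + t\<^sup>2)"
    by simp
  ultimately have \<nu>: "\<nu> \<noteq> 0"
    by (metis norm_zero not_less)
  then have \<theta>: "\<theta> < 1"
    using sless by (simp add: \<theta>_def)
  have bound: "norm (h * e + (\<i> * complex_of_real t) *\<^sub>C e) \<le> sqrt ((norm h)\<^sup>2 + t\<^sup>2) * norm e" for e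
  proof -
    let ?u = "h * e + (\<i> * complex_of_real t) *\<^sub>C e"
    have "?u\<^sup>\<star> * ?u = e\<^sup>\<star> * (h * (h * e) + (t\<^sup>2) *\<^sub>R e)"
      by (simp add: adj_simps h scaleC_simps scaleC_minus_left algebra_simps power2_eq_square
          flip: scaleC_of_real)
    then have "(norm ?u)\<^sup>2 = norm (e\<^sup>\<star> * (h * (h * e) + (t\<^sup>2) *\<^sub>R e))"
      by (metis cstar_identity)
    also have "\<dots> \<le> norm e * norm (h * (h * e) + (t\<^sup>2) *\<^sub>R e)"
      by (metis norm_mult_ineq norm_adj)
    also have "\<dots> \<le> norm e * (norm h * (norm h * norm e) + t\<^sup>2 * norm e)"
      by (intro mult_left_mono norm_ge_zero)
        (smt (verit) norm_triangle_ineq norm_mult_ineq mult_left_mono norm_ge_zero norm_scaleR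
          zero_le_power2 abs_of_nonneg)
    finally have "(norm ?u)\<^sup>2 \<le> ((norm h)\<^sup>2 + t\<^sup>2) * (norm e)\<^sup>2"
      by (simp add: algebra_simps power2_eq_square)
    then show ?thesis
      by (metis norm_ge_zero real_le_rsqrt real_sqrt_mult real_sqrt_unique)
  qed
  have "norm ((1 / \<nu>) *\<^sub>C (h * c + (\<i> * complex_of_real t) *\<^sub>C c - h)
      - (1 / \<nu>) *\<^sub>C (h * d + (\<i> * complex_of_real t) *\<^sub>C d - h)) \<le> \<theta> * norm (c - d)" for c d
  proof -
    have "(1 / \<nu>) *\<^sub>C (h * c + (\<i> * complex_of_real t) *\<^sub>C c - h)
      - (1 / \<nu>) *\<^sub>C (h * d + (\<i> * complex_of_real t) *\<^sub>C d - h)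
      = (1 / \<nu>) *\<^sub>C (h * (c - d) + (\<i> * complex_of_real t) *\<^sub>C (c - d))"
      by (simp add: scaleC_simps algebra_simps)
    then show ?thesis
      using bound[of "c - d"] \<nu> by (simp add: norm_scaleC norm_divide \<theta>_def divide_right_mono)
  qed
  from contraction_fixpoint[OF \<theta> this]
  obtain c where c: "(1 / \<nu>) *\<^sub>C (h * c + (\<i> * complex_of_real t) *\<^sub>C c - h) = c" ..
  have "\<nu> *\<^sub>C c = h * c + (\<i> * complex_of_real t) *\<^sub>C c - h"
    using \<nu> by (subst c[symmetric]) (simp add: scaleC_scaleC)
  then have "h + z *\<^sub>C c = h * c"
    by (simp add: \<nu>_def scaleC_add_left algebra_simps)
  then show ?thesis ..
qed

lemma quasi_invertible_nonreal:
  fixes h :: "'a::cstar_algebra"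
  assumes h: "h\<^sup>\<star> = h" and z: "Im z \<noteq> 0"
  shows "\<exists>c. quasi_inverse ((1 / z) *\<^sub>C h) c"
proof -
  have z0: "z \<noteq> 0"
    using z by auto
  obtain c where c: "h * c = h + z *\<^sub>C c"
    using right_quasi_inverse_nonreal[OF h z] by metis
  obtain d where d: "h * d = h + cnj z *\<^sub>C d"
    using right_quasi_inverse_nonreal[OF h, of "cnj z"] z by (metis cnj.sel(2) neg_equal_0_iff_equal)
  (* The adjoint of the equation for the conjugate of z is the left-handed equation for z. *)
  have d': "d\<^sup>\<star> * h = h + z *\<^sub>C d\<^sup>\<star>"
    using arg_cong[OF d, of adj] by (simp add: adj_simps h)
  show ?thesis
    by (rule exI[of _ c], rule quasi_inverseI[where c = "d\<^sup>\<star>"])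
      (use z0 in \<open>simp_all add: scaleC_simps c d'\<close>)
qed


section \<open>The spectral radius of a selfadjoint element\<close>

text \<open>
  The quasi-inverse depends continuously on \<open>\<omega>\<close>, and the circle is compact.
\<close>

lemma quasi_inverses_bounded_on_circle:
  fixes k :: "'a::complex_banach_algebra"
  assumes "\<And>\<omega>. cmod \<omega> = 1 \<Longrightarrow> \<exists>g. quasi_inverse (\<omega> *\<^sub>C k) g"
  shows "\<exists>M. \<forall>\<omega> g. cmod \<omega> = 1 \<longrightarrow> quasi_inverse (\<omega> *\<^sub>C k) g \<longrightarrow> norm g \<le> M"
proof -
  obtain G where G: "quasi_inverse (\<omega> *\<^sub>C k) (G \<omega>)" if "cmod \<omega> = 1" for \<omega>
    using assms by metis
  have "continuous_on (sphere 0 1) G"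
    unfolding continuous_on_iff
  proof (intro ballI allI impI)
    fix \<omega> :: complex and e :: real
    assume "\<omega> \<in> sphere 0 1" and e: "0 < e"
    then have \<omega>: "cmod \<omega> = 1"
      by simp
    define C where "C = 1 + norm (G \<omega>)"
    have C: "C > 0"
      by (simp add: C_def add_pos_nonneg)
    define \<kappa> where "\<kappa> = norm k + 1"
    have \<kappa>: "\<kappa> > 0" "norm k \<le> \<kappa>"
      by (simp_all add: \<kappa>_def add_nonneg_pos)
    define d where "d = min (1 / (2 * C * \<kappa>)) (e / (2 * C\<^sup>2 * \<kappa>))"
    have "d > 0"
      using C \<kappa> e by (simp add: d_def)
    moreover have "dist (G \<omega>') (G \<omega>) < e" if "\<omega>' \<in> sphere 0 1" "dist \<omega>' \<omega> < d" for \<omega>'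
    proof -
      let ?c = "(\<omega>' - \<omega>) *\<^sub>C k"
      have "norm ?c \<le> cmod (\<omega>' - \<omega>) * \<kappa>"
        using \<kappa> by (simp add: norm_scaleC mult_left_mono)
      also have "\<dots> < d * \<kappa>"
        using that \<kappa> by (simp add: dist_norm)
      finally have c: "norm ?c < d * \<kappa>" .
      have "norm ?c * C < d * \<kappa> * C"
        using c C by simp
      also have "\<dots> \<le> (1 / (2 * C * \<kappa>)) * \<kappa> * C"
        using C \<kappa> by (intro mult_right_mono) (auto simp: d_def)
      also have "\<dots> = 1/2"
        using C \<kappa> by simp
      finally have "norm ?c * C \<le> 1/2" by simp
      from quasi_inverse_perturb[OF G[OF \<omega>] _ this]
      obtain g where g: "quasi_inverse (\<omega> *\<^sub>C k + ?c) g" "norm (g - G \<omega>) \<le> 2 * norm ?c * C\<^sup>2"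
        by (auto simp: C_def)
      have "g = G \<omega>'"
        using g(1) G[of \<omega>'] that quasi_inverse_unique by (auto simp: scaleC_diff_left)
      have "2 * norm ?c * C\<^sup>2 < 2 * (d * \<kappa>) * C\<^sup>2"
        using c C by simp
      also have "\<dots> \<le> 2 * ((e / (2 * C\<^sup>2 * \<kappa>)) * \<kappa>) * C\<^sup>2"
        using C \<kappa> by (intro mult_right_mono mult_left_mono) (auto simp: d_def)
      also have "\<dots> = e"
        using C \<kappa> by simp
      finally show ?thesis
        using g(2) \<open>g = G \<omega>'\<close> by (simp add: dist_norm)
    qed
    ultimately show "\<exists>d>0. \<forall>\<omega>'\<in>sphere 0 1. dist \<omega>' \<omega> < d \<longrightarrow> dist (G \<omega>') (G \<omega>) < e"
      by blast
  qed
  then have "bounded (G ` sphere 0 1)"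
    by (intro compact_imp_bounded compact_continuous_image) auto
  then obtain M where "\<forall>\<omega>\<in>sphere 0 1. norm (G \<omega>) \<le> M"
    by (auto simp: bounded_iff)
  then show ?thesis
    using G quasi_inverse_unique by (metis mem_sphere_0)
qed

text \<open>
  A resolvent estimate relating the circles of radii \<open>r\<close> and \<open>r'\<close>. The constant \<open>1/3\<close> has only
  to be less than \<open>1/2\<close>, which the norm of a quasi-inverse of an element of norm greater than 1
  always exceeds.
\<close>

definition resolvents_close :: "real \<Rightarrow> real \<Rightarrow> 'a::complex_banach_algebra \<Rightarrow> bool"
  where "resolvents_close r r' k \<longleftrightarrow> (\<forall>\<omega>. cmod \<omega> = 1 \<longrightarrow>
    (\<exists>g g'. quasi_inverse ((of_real r * \<omega>) *\<^sub>C k) g \<and> quasi_inverse ((of_real r' * \<omega>) *\<^sub>C k) g' \<and>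
      norm (g - g') \<le> 1/3))"

text \<open>
  Apply the partial fraction at both square roots of \<open>\<omega>\<close>.
\<close>

lemma resolvents_close_square:
  fixes k :: "'a::complex_banach_algebra"
  assumes "resolvents_close r r' k"
  shows "resolvents_close (r\<^sup>2) (r'\<^sup>2) (k * k)"
  unfolding resolvents_close_def
proof (intro allI impI)
  fix \<omega> :: complex
  assume "cmod \<omega> = 1"
  define \<eta> where "\<eta> = csqrt \<omega>"
  have \<eta>: "\<eta> * \<eta> = \<omega>"
    unfolding \<eta>_def by (metis power2_csqrt power2_eq_square)
  have \<eta>1: "cmod \<eta> = 1" "cmod (- \<eta>) = 1"
    using \<open>cmod \<omega> = 1\<close> by (simp_all add: \<eta>_def)
  obtain g g' where g: "quasi_inverse ((of_real r * \<eta>) *\<^sub>C k) g"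
      "quasi_inverse ((of_real r' * \<eta>) *\<^sub>C k) g'" "norm (g - g') \<le> 1/3"
    using assms \<eta>1(1) unfolding resolvents_close_def by blast
  obtain h h' where h: "quasi_inverse (- ((of_real r * \<eta>) *\<^sub>C k)) h"
      "quasi_inverse (- ((of_real r' * \<eta>) *\<^sub>C k)) h'" "norm (h - h') \<le> 1/3"
    using assms \<eta>1(2) unfolding resolvents_close_def
    by (metis mult_minus_right scaleC_minus_left)
  have sq: "((of_real x * \<eta>) *\<^sub>C k) * ((of_real x * \<eta>) *\<^sub>C k) = (of_real (x\<^sup>2) * \<omega>) *\<^sub>C (k * k)" for x
    by (simp add: scaleC_simps power2_eq_square mult.assoc mult.left_commute flip: \<eta>)
  have "(1/2) *\<^sub>R (g + h) - (1/2) *\<^sub>R (g' + h') = (1/2) *\<^sub>R ((g - g') + (h - h'))"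
    by (simp add: algebra_simps)
  then have "norm ((1/2) *\<^sub>R (g + h) - (1/2) *\<^sub>R (g' + h')) = norm ((g - g') + (h - h')) / 2"
    by simp
  also have "\<dots> \<le> 1/3"
    using g(3) h(3) norm_triangle_ineq[of "g - g'" "h - h'"] by simp
  finally show "\<exists>g g'. quasi_inverse ((of_real (r\<^sup>2) * \<omega>) *\<^sub>C (k * k)) g \<and>
      quasi_inverse ((of_real (r'\<^sup>2) * \<omega>) *\<^sub>C (k * k)) g' \<and> norm (g - g') \<le> 1/3"
    using quasi_inverse_square[OF g(1) h(1)] quasi_inverse_square[OF g(2) h(2)] sq by metis
qed

lemma norm_square_selfadjoint:
  fixes k :: "'a::cstar_algebra"
  assumes "k\<^sup>\<star> = k"
  shows "norm (k * k) = (norm k)\<^sup>2"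
  using cstar_identity[of k] assms by simp

text \<open>
  If the resolvent existed on the whole unit circle, it would be bounded there by compactness, so
  its values on the circles of radii \<open>1 - \<delta>\<close> and \<open>1 + \<delta>\<close> would be close for small \<open>\<delta>\<close>. Squaring
  \<open>k\<close> repeatedly preserves this closeness and, as \<open>k\<close> is selfadjoint, also the norm 1, while the
  radii become \<open>(1 - \<delta>) ^ 2 ^ n\<close> and \<open>(1 + \<delta>) ^ 2 ^ n\<close>. On the inner circle the quasi-inverses
  tend to 0; on the outer one they have norm more than \<open>1/2\<close>, since they belong to elements of
  norm greater than 1.
\<close>

lemma exists_not_quasi_invertible_on_circle:
  fixes k :: "'a::cstar_algebra"
  assumes k: "k\<^sup>\<star> = k" "norm k = 1"
  shows "\<exists>\<omega>. cmod \<omega> = 1 \<and> (\<nexists>g. quasi_inverse (\<omega> *\<^sub>C k) g)"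
proof (rule ccontr)
  assume contra: "\<not> ?thesis"
  then have qi: "\<exists>g. quasi_inverse (\<omega> *\<^sub>C k) g" if "cmod \<omega> = 1" for \<omega>
    using that by blast
  obtain M where M: "\<And>\<omega> g. cmod \<omega> = 1 \<Longrightarrow> quasi_inverse (\<omega> *\<^sub>C k) g \<Longrightarrow> norm g \<le> M"
    using quasi_inverses_bounded_on_circle[of k] qi by blast
  (* C bounds the inverses on the circle; delta makes the perturbation bound 2 * delta * C^2
     equal to 1/6, half of the admissible distance. *)
  define C where "C = 1 + max 0 M"
  have C: "C \<ge> 1"
    by (simp add: C_def)
  define \<delta> where "\<delta> = 1 / (12 * C\<^sup>2)"
  have C2: "C \<le> C\<^sup>2"
    using C by (simp add: self_le_power)
  have \<delta>: "0 < \<delta>" "\<delta> < 1" "\<delta> * C \<le> 1/2" "2 * \<delta> * C\<^sup>2 = 1/6"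
    using C C2 by (simp_all add: \<delta>_def field_simps)
  have close: "resolvents_close (1 - \<delta>) (1 + \<delta>) k"
    unfolding resolvents_close_def
  proof (intro allI impI)
    fix \<omega> :: complex
    assume \<omega>: "cmod \<omega> = 1"
    obtain b where b: "quasi_inverse (\<omega> *\<^sub>C k) b"
      using qi \<omega> by blast
    have bC: "1 + norm b \<le> C"
      using M[OF \<omega> b] by (simp add: C_def)
    have near: "\<exists>g. quasi_inverse ((of_real (1 + x) * \<omega>) *\<^sub>C k) g \<and> norm (g - b) \<le> 1/6"
      if "\<bar>x\<bar> = \<delta>" for x
    proof -
      let ?c = "(of_real x * \<omega>) *\<^sub>C k"
      have nc: "norm ?c = \<delta>"
        using that \<omega> k by (simp add: norm_scaleC norm_mult)
      have "\<omega> *\<^sub>C k + ?c = (of_real (1 + x) * \<omega>) *\<^sub>C k"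
        by (simp add: scaleC_add_left algebra_simps)
      then show ?thesis
        using quasi_inverse_perturb[OF b bC, of ?c] \<delta> by (simp add: nc)
    qed
    obtain g where g: "quasi_inverse ((of_real (1 - \<delta>) * \<omega>) *\<^sub>C k) g" "norm (g - b) \<le> 1/6"
      using near[of "- \<delta>"] \<delta> by auto
    obtain g' where g': "quasi_inverse ((of_real (1 + \<delta>) * \<omega>) *\<^sub>C k) g'" "norm (g' - b) \<le> 1/6"
      using near[of \<delta>] \<delta> by auto
    have "norm (g - g') \<le> 1/3"
      using g(2) g'(2) norm_triangle_ineq4[of "g - b" "g' - b"] by simp
    then show "\<exists>g g'. quasi_inverse ((of_real (1 - \<delta>) * \<omega>) *\<^sub>C k) g \<and>
        quasi_inverse ((of_real (1 + \<delta>) * \<omega>) *\<^sub>C k) g' \<and> norm (g - g') \<le> 1/3"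
      using g(1) g'(1) by blast
  qed
  have iter: "\<exists>h::'a. h\<^sup>\<star> = h \<and> norm h = 1 \<and> resolvents_close ((1 - \<delta>) ^ 2 ^ n) ((1 + \<delta>) ^ 2 ^ n) h" for n
  proof (induction n)
    case 0
    then show ?case
      using k close by auto
  next
    case (Suc n)
    then obtain h :: 'a where h: "h\<^sup>\<star> = h" "norm h = 1"
        "resolvents_close ((1 - \<delta>) ^ 2 ^ n) ((1 + \<delta>) ^ 2 ^ n) h"
      by blast
    have "(h * h)\<^sup>\<star> = h * h \<and> norm (h * h) = 1"
      using h by (simp add: adj_mult norm_square_selfadjoint)
    then show ?case
      using resolvents_close_square[OF h(3)]
      by (auto simp: mult.commute[of 2] power_mult)
  qed
  (* An element of norm \<rho> < 1/7 has a quasi-inverse of norm at most \<rho> / (1 - \<rho>) < 1/6 = 1/2 - 1/3. *)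
  obtain m where m: "(1 - \<delta>) ^ m < 1/7"
    using real_arch_pow_inv[of "1/7" "1 - \<delta>"] \<delta> by auto
  have "(1 - \<delta>) ^ 2 ^ m \<le> (1 - \<delta>) ^ m"
    using \<delta> less_exp[of m] by (intro power_decreasing) auto
  then have small: "(1 - \<delta>) ^ 2 ^ m < 1/7"
    using m by linarith
  obtain h :: 'a where h: "norm h = 1"
      "resolvents_close ((1 - \<delta>) ^ 2 ^ m) ((1 + \<delta>) ^ 2 ^ m) h"
    using iter[of m] by blast
  define \<rho> \<rho>' where "\<rho> = (1 - \<delta>) ^ 2 ^ m" and "\<rho>' = (1 + \<delta>) ^ 2 ^ m"
  have \<rho>: "0 \<le> \<rho>" "\<rho> < 1/7" and \<rho>': "1 < \<rho>'"
    using small \<delta> by (auto simp: \<rho>_def \<rho>'_def intro!: one_less_power)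
  obtain g g' where g: "quasi_inverse (of_real \<rho> *\<^sub>C h) g" and g': "quasi_inverse (of_real \<rho>' *\<^sub>C h) g'"
      and gg': "norm (g - g') \<le> 1/3"
    using h(2)[unfolded resolvents_close_def, rule_format, of 1] by (auto simp: \<rho>_def \<rho>'_def)
  have "norm g \<le> \<rho> / (1 - \<rho>)"
    using norm_quasi_inverse_le[OF g] \<rho> h(1) by (simp add: norm_scaleC)
  also have "\<dots> \<le> 1/6"
    using \<rho> by (simp add: field_simps)
  finally have "norm g' \<le> 1/2"
    using gg' norm_triangle_ineq4[of g "g - g'"] by simp
  moreover have "of_real \<rho>' *\<^sub>C h = (of_real \<rho>' *\<^sub>C h) * g' - g'"
    using g' by (simp add: quasi_inverse_def algebra_simps)
  then have "\<rho>' \<le> \<rho>' * norm g' + norm g'"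
    using norm_triangle_ineq4[of "(of_real \<rho>' *\<^sub>C h) * g'" g'] \<rho>' h(1)
      norm_mult_ineq[of "of_real \<rho>' *\<^sub>C h" g'] by (simp add: norm_scaleC)
  moreover have "\<rho>' * norm g' \<le> \<rho>' * (1/2)"
    using calculation(1) \<rho>' by (intro mult_left_mono) auto
  ultimately show False
    using \<rho>' by linarith
qed

lemma norm_less_1_if_quasi_invertible_on_disc:
  fixes k :: "'a::cstar_algebra"
  assumes k: "k\<^sup>\<star> = k" and qi: "\<And>\<zeta>. cmod \<zeta> \<le> 1 \<Longrightarrow> \<exists>g. quasi_inverse (\<zeta> *\<^sub>C k) g"
  shows "norm k < 1"
proof (rule ccontr)
  assume "\<not> norm k < 1"
  then have nk: "norm k \<ge> 1" by simp
  define k' where "k' = (1 / norm k) *\<^sub>R k"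
  have "k'\<^sup>\<star> = k'" "norm k' = 1"
    using k nk by (auto simp: k'_def adj_scaleR)
  then obtain \<omega> where \<omega>: "cmod \<omega> = 1" "\<nexists>g. quasi_inverse (\<omega> *\<^sub>C k') g"
    using exists_not_quasi_invertible_on_circle by blast
  have "\<omega> *\<^sub>C k' = (\<omega> * of_real (1 / norm k)) *\<^sub>C k"
    unfolding k'_def by (simp only: scaleC_scaleC flip: scaleC_of_real)
  moreover have "cmod (\<omega> * of_real (1 / norm k)) \<le> 1"
    using \<omega> nk by (simp add: norm_mult norm_divide divide_le_eq_1)
  ultimately show False
    using qi \<omega>(2) by metis
qed

section \<open>Positive elements\<close>

text \<open>
  Positivity means invertibility of \<open>1 + \<mu> b\<close> for \<open>\<mu> > 0\<close>: nonreal spectral values are excluded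
  already, and \<open>\<mu>\<close> corresponds to the negative number \<open>- 1 / \<mu>\<close>.
\<close>

lemma cstar_positive_iff:
  fixes b :: "'a::cstar_algebra"
  shows "cstar_positive b \<longleftrightarrow> b\<^sup>\<star> = b \<and> (\<forall>\<mu>>0. \<exists>g. quasi_inverse (- (\<mu> *\<^sub>R b)) g)"
proof (cases "b\<^sup>\<star> = b")
  case True
  have "spectrum b \<subseteq> complex_of_real ` {0..} \<longleftrightarrow> (\<forall>\<mu>>0. \<exists>g. quasi_inverse (- (\<mu> *\<^sub>R b)) g)"
  proof (intro iffI allI impI subsetI)
    fix \<mu> :: real
    assume "spectrum b \<subseteq> complex_of_real ` {0..}" and \<mu>: "0 < \<mu>"
    moreover have "of_real (- (1 / \<mu>)) \<notin> complex_of_real ` {0..}"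
    proof
      assume "complex_of_real (- (1 / \<mu>)) \<in> complex_of_real ` {0..}"
      then have "- (1 / \<mu>) \<ge> 0"
        by (metis atLeast_iff image_iff of_real_eq_iff)
      then show False
        using \<mu> by simp
    qed
    ultimately have "of_real (- (1 / \<mu>)) \<notin> spectrum b"
      by blast
    moreover have "complex_of_real (- (1 / \<mu>)) \<noteq> 0"
      using \<mu> by simp
    ultimately have "\<exists>g. quasi_inverse ((1 / of_real (- (1 / \<mu>))) *\<^sub>C b) g"
      using spectrum_compl_iff by blast
    moreover have "1 / complex_of_real (- (1 / \<mu>)) = of_real (- \<mu>)"
      by simp
    ultimately show "\<exists>g. quasi_inverse (- (\<mu> *\<^sub>R b)) g"
      by (simp only: scaleC_of_real scaleR_minus_left)
  next
    fix z
    assume qi: "\<forall>\<mu>>0. \<exists>g. quasi_inverse (- (\<mu> *\<^sub>R b)) g" and z: "z \<in> spectrum b"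
    have real: "Im z = 0"
    proof (rule ccontr)
      assume nonreal: "Im z \<noteq> 0"
      then have "z \<noteq> 0"
        by auto
      then show False
        using quasi_invertible_nonreal[OF True nonreal] spectrum_compl_iff[of z b] z by blast
    qed
    have "\<not> Re z < 0"
    proof
      assume neg: "Re z < 0"
      define \<mu> where "\<mu> = - (1 / Re z)"
      have "\<mu> > 0" "z \<noteq> 0"
        using neg by (auto simp: \<mu>_def)
      have "z = of_real (Re z)"
        using real by (simp add: complex_eq_iff)
      then have "1 / z = of_real (- \<mu>)"
        by (metis \<mu>_def minus_minus of_real_1 of_real_divide)
      then have "(1 / z) *\<^sub>C b = - (\<mu> *\<^sub>R b)"
        by (simp only: scaleC_of_real scaleR_minus_left)
      then show False
        using qi[rule_format, OF \<open>\<mu> > 0\<close>] spectrum_compl_iff[OF \<open>z \<noteq> 0\<close>, of b] z by simp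
    qed
    then show "z \<in> complex_of_real ` {0..}"
      using real by (intro image_eqI[of _ _ "Re z"]) (auto simp: complex_eq_iff)
  qed
  then show ?thesis
    using True by (simp add: cstar_positive_def)
qed (simp add: cstar_positive_def)

lemma cstar_positive_scaleR:
  assumes "cstar_positive b" "0 < r"
  shows "cstar_positive (r *\<^sub>R b)"
  unfolding cstar_positive_iff
proof (intro conjI allI impI)
  show "(r *\<^sub>R b)\<^sup>\<star> = r *\<^sub>R b"
    using assms by (simp add: cstar_positive_iff adj_scaleR)
  fix \<mu> :: real
  assume "0 < \<mu>"
  then show "\<exists>g. quasi_inverse (- (\<mu> *\<^sub>R r *\<^sub>R b)) g"
    using assms mult_pos_pos[of \<mu> r] unfolding cstar_positive_iff scaleR_scaleR by blast
qed

lemma cstar_positive_if_cube: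
  fixes b :: "'a::cstar_algebra"
  assumes b: "b\<^sup>\<star> = b" and pos: "cstar_positive (b * b * b)"
  shows "cstar_positive b"
  unfolding cstar_positive_iff
proof (intro conjI allI impI b)
  fix \<mu> :: real
  assume "0 < \<mu>"
  then obtain g where "quasi_inverse (- (\<mu> ^ 3 *\<^sub>R (b * b * b))) g"
    using pos zero_less_power[of \<mu> 3] unfolding cstar_positive_iff by blast
  moreover have "- (\<mu> ^ 3 *\<^sub>R (b * b * b)) = (- (\<mu> *\<^sub>R b)) * (- (\<mu> *\<^sub>R b)) * (- (\<mu> *\<^sub>R b))"
    by (simp add: power3_eq_cube)
  ultimately show "\<exists>g. quasi_inverse (- (\<mu> *\<^sub>R b)) g"
    using quasi_invertible_if_cube by metis
qed

text \<open>
  Here \<open>k = b (1 + b)\<inverse>\<close>, whose spectrum lies in the image \<open>[0, 1)\<close> of the nonnegative half-line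
  under \<open>\<lambda> / (1 + \<lambda>)\<close>. Concretely, \<open>1 - \<zeta> k = (1 + (1 - \<zeta>) b) (1 + b)\<inverse>\<close>, and the first factor
  is invertible for \<open>cmod \<zeta> \<le> 1\<close>: unless \<open>\<zeta> = 1\<close>, this is because \<open>- 1 / (1 - \<zeta>)\<close> has negative real part.
\<close>

lemma norm_quasi_inverse_positive:
  fixes b :: "'a::cstar_algebra"
  assumes pos: "cstar_positive b" and k: "quasi_inverse (- b) k"
  shows "norm k < 1"
proof (rule norm_less_1_if_quasi_invertible_on_disc)
  have "quasi_inverse (- b) (k\<^sup>\<star>)"
    using quasi_inverse_adj[OF k] pos by (simp add: cstar_positive_def adj_minus)
  then show "k\<^sup>\<star> = k"
    using k quasi_inverse_unique by blast
next
  fix \<zeta> :: complex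
  assume \<zeta>: "cmod \<zeta> \<le> 1"
  define y where "y = (1 - \<zeta>) *\<^sub>C b"
  have "\<exists>j. quasi_inverse (- y) j"
  proof (cases "\<zeta> = 1")
    case True
    then show ?thesis
      by (intro exI[of _ 0]) (simp add: y_def quasi_inverse_def)
  next
    case False
    define z where "z = - (1 / (1 - \<zeta>))"
    have "Re \<zeta> < 1"
    proof (rule ccontr)
      assume "\<not> Re \<zeta> < 1"
      moreover have "(Re \<zeta>)\<^sup>2 + (Im \<zeta>)\<^sup>2 \<le> 1"
        using \<zeta> by (simp add: cmod_def)
      moreover have "Re \<zeta> = 1"
        using complex_Re_le_cmod[of \<zeta>] \<zeta> calculation(1) by linarith
      ultimately have "Re \<zeta> = 1" "Im \<zeta> = 0"
        by auto
      then show False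
        using False by (simp add: complex_eq_iff)
    qed
    then have "Re z < 0"
      using False by (simp add: z_def Re_divide' divide_pos_pos)
    then have "z \<notin> complex_of_real ` {0..}" "z \<noteq> 0"
      by auto
    then have "\<exists>g. quasi_inverse ((1 / z) *\<^sub>C b) g"
      using pos spectrum_compl_iff[of z b] by (auto simp: cstar_positive_def)
    moreover have "1 / z = - (1 - \<zeta>)"
      by (simp add: z_def)
    ultimately show ?thesis
      by (simp only: y_def scaleC_minus_left)
  qed
  then obtain j where j: "quasi_inverse (- y) j" ..
  have "b * k = b - k"
    using k by (simp add: quasi_inverse_def algebra_simps)
  then have "y * k = y - (1 - \<zeta>) *\<^sub>C k"
    by (simp add: y_def scaleC_simps)
  then have "- y + k - (- y) * k = \<zeta> *\<^sub>C k"
    by (simp add: scaleC_diff_left)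
  moreover have "quasi_inverse k (- b)"
    by (rule quasi_inverse_sym[OF k])
  ultimately show "\<exists>g. quasi_inverse (\<zeta> *\<^sub>C k) g"
    using quasi_inverse_comp[OF j] by metis
qed

text \<open>
  The inverse \<open>1 - k\<close> of \<open>1 + \<mu> c\<close> has norm bound 2 for every positive \<open>c\<close>, so that \<open>1 + \<mu> b\<close> is
  invertible as soon as one positive \<open>c\<close> is within \<open>1 / (4 \<mu>)\<close> of \<open>b\<close>.
\<close>

lemma cstar_positive_closed:
  fixes b :: "'a::cstar_algebra"
  assumes b: "b\<^sup>\<star> = b" and approx: "\<And>\<epsilon>. 0 < \<epsilon> \<Longrightarrow> \<exists>c. cstar_positive c \<and> norm (b - c) \<le> \<epsilon>"
  shows "cstar_positive b"
  unfolding cstar_positive_iff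
proof (intro conjI allI impI b)
  fix \<mu> :: real
  assume \<mu>: "0 < \<mu>"
  then obtain c where c: "cstar_positive c" "norm (b - c) \<le> 1 / (4 * \<mu>)"
    using approx[of "1 / (4 * \<mu>)"] by auto
  then obtain k where k: "quasi_inverse (- (\<mu> *\<^sub>R c)) k"
    using \<mu> by (auto simp: cstar_positive_iff)
  have "norm k < 1"
    using norm_quasi_inverse_positive[OF cstar_positive_scaleR[OF c(1) \<mu>] k] .
  moreover have "norm (\<mu> *\<^sub>R (c - b)) = \<mu> * norm (b - c)"
    using \<mu> by (simp add: norm_minus_commute)
  then have "norm (\<mu> *\<^sub>R (c - b)) * 2 \<le> 1/2"
    using c(2) \<mu> by (simp add: field_simps)
  ultimately show "\<exists>g. quasi_inverse (- (\<mu> *\<^sub>R b)) g"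
    using quasi_inverse_perturb[OF k, of 2 "\<mu> *\<^sub>R (c - b)"] by (auto simp: scaleR_diff_right)
qed

section \<open>A quadratic equation solved by a square root\<close>

text \<open>
  In the unitization, \<open>u = 1/2 + v\<close> satisfies \<open>2 u - w u\<^sup>2 = 1\<close>, so it plays the role of
  \<open>(1 - sqrt (1 - w)) / w\<close>. Halving the equation for \<open>v\<close> gives a map with Lipschitz constant
  \<open>norm w\<close> on the ball of radius \<open>1/2\<close>; it is restricted to the selfadjoint elements that commute
  with \<open>w\<close>, a closed set that it preserves.
\<close>

lemma exists_square_root_solution:
  fixes w :: "'a::cstar_algebra"
  assumes w: "w\<^sup>\<star> = w" "norm w < 1"
  shows "\<exists>v. v\<^sup>\<star> = v \<and> v * w = w * v \<and> 2 *\<^sub>R v = (1/4) *\<^sub>R w + w * v + w * (v * v)"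
proof -
  define X where "X = {v. v\<^sup>\<star> = v \<and> v * w = w * v \<and> norm v \<le> 1/2}"
  define T where "T v = (1/8) *\<^sub>R w + (1/2) *\<^sub>R (w * v + w * (v * v))" for v
  have cont_adj: "continuous_on UNIV (adj :: 'a \<Rightarrow> 'a)"
    unfolding continuous_on_iff
    by (metis adj_diff dist_norm norm_adj)
  have "closed X"
    unfolding X_def
    by (intro closed_Collect_conj closed_Collect_eq closed_Collect_le continuous_intros cont_adj)
  then have "complete X"
    by (simp add: complete_eq_closed)
  moreover have "0 \<in> X"
    using adj_scaleR[of 0 "0::'a"] by (simp add: X_def)
  moreover have "T ` X \<subseteq> X"
  proof
    fix u assume "u \<in> T ` X"
    then obtain v where u: "u = T v" and v: "v\<^sup>\<star> = v" "v * w = w * v" "norm v \<le> 1/2"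
      by (auto simp: X_def)
    have vw: "v * (v * w) = w * (v * v)" "v * (w * v) = w * (v * v)" "v * (v * (v * w)) = w * (v * (v * v))"
      using v(2) by (metis mult.assoc)+
    have "u\<^sup>\<star> = u"
      using v(2) by (simp add: u T_def adj_simps w v mult.assoc vw)
    moreover have "u * w = w * u"
      using v(2) vw by (simp add: u T_def algebra_simps)
    moreover have "norm u \<le> 1/2"
    proof -
      have "norm (w * z) \<le> norm z" for z
        using norm_mult_ineq[of w z] w(2) mult_right_mono[of "norm w" 1 "norm z"] by simp
      then have "norm (w * v) \<le> 1/2" "norm (w * (v * v)) \<le> norm v * norm v"
        using v(3) norm_mult_ineq[of v v] by (meson order_trans)+
      moreover have "norm v * norm v \<le> 1/4"
        using mult_mono[OF v(3) v(3)] by simp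
      moreover have "norm u \<le> (1/8) * norm w + (1/2) * (norm (w * v) + norm (w * (v * v)))"
        unfolding u T_def
        by (rule order_trans[OF norm_triangle_ineq]) (simp add: norm_triangle_ineq)
      ultimately have "norm u \<le> (1/8) * norm w + (1/2) * (1/2 + 1/4)"
        by argo
      then show ?thesis
        using w(2) by simp
    qed
    ultimately show "u \<in> X"
      by (simp add: X_def)
  qed
  moreover have "dist (T v) (T v') \<le> norm w * dist v v'" if "v \<in> X" "v' \<in> X" for v v'
  proof -
    have bd: "norm v \<le> 1/2" "norm v' \<le> 1/2"
      using that by (auto simp: X_def)
    let ?e = "v - v'"
    have "T v - T v' = (1/2) *\<^sub>R (w * (?e + (v * ?e + ?e * v')))"
      by (simp add: T_def algebra_simps)
    then have "norm (T v - T v') \<le> (1/2) * (norm w * norm (?e + (v * ?e + ?e * v')))"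
      by (simp add: norm_mult_ineq)
    moreover have "norm (?e + (v * ?e + ?e * v')) \<le> 2 * norm ?e"
    proof -
      have "norm (v * ?e) \<le> (1/2) * norm ?e" "norm (?e * v') \<le> norm ?e * (1/2)"
        using bd norm_mult_ineq order_trans mult_right_mono mult_left_mono norm_ge_zero by metis+
      then show ?thesis
        using norm_triangle_ineq[of ?e "v * ?e + ?e * v'"] norm_triangle_ineq[of "v * ?e" "?e * v'"]
        by linarith
    qed
    then have "norm w * norm (?e + (v * ?e + ?e * v')) \<le> norm w * (2 * norm ?e)"
      by (intro mult_left_mono) auto
    ultimately show ?thesis
      by (simp add: dist_norm)
  qed
  ultimately have "\<exists>!v\<in>X. T v = v"
    using w(2) by (intro Banach_fix[where c = "norm w"]) auto
  then obtain v where "v \<in> X" "T v = v"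
    by blast
  then have "2 *\<^sub>R v = 2 *\<^sub>R T v" "v\<^sup>\<star> = v" "v * w = w * v"
    by (auto simp: X_def)
  then show ?thesis
    by (auto simp: T_def scaleR_add_right)
qed

section \<open>Two-point kernels\<close>

lemma conditionally_positive_definite_two_points:
  assumes "conditionally_positive_definite_kernel S K" "s \<in> S" "t \<in> S"
  shows "cstar_positive (b\<^sup>\<star> * (K s s + K t t - (K s t + K t s)) * b)"
proof -
  define p where "p i = (if i = 1 then s else t)" for i :: nat
  define a where "a i = (if i = 1 then b else - b)" for i :: nat
  have "\<forall>i\<in>{1..2}. p i \<in> S"
    using assms(2,3) by (simp add: p_def)
  moreover have "(\<Sum>i=1..2. a i) = 0"
    by (simp add: a_def numeral_2_eq_2)
  ultimately have "cstar_positive (\<Sum>i=1..2. \<Sum>j=1..2. (a i)\<^sup>\<star> * K (p i) (p j) * a j)"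
    using assms(1)[unfolded conditionally_positive_definite_kernel_def, THEN conjunct2,
        rule_format, of 2 p a] by (simp add: cstar_le_def)
  then show ?thesis
    by (simp add: a_def p_def numeral_2_eq_2 adj_simps algebra_simps)
qed

lemma positive_definite_two_points:
  assumes "positive_definite_kernel S L" "s \<in> S" "t \<in> S"
  shows "cstar_positive (a\<^sup>\<star> * L s s * a + a\<^sup>\<star> * L s t * b + b\<^sup>\<star> * L t s * a + b\<^sup>\<star> * L t t * b)"
proof -
  define p where "p i = (if i = 1 then s else t)" for i :: nat
  define c where "c i = (if i = 1 then a else b)" for i :: nat
  have "\<forall>i\<in>{1..2}. p i \<in> S"
    using assms(2,3) by (simp add: p_def)
  then have "cstar_positive (\<Sum>i=1..2. \<Sum>j=1..2. (c i)\<^sup>\<star> * L (p i) (p j) * c j)"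
    using assms(1)[unfolded positive_definite_kernel_def, THEN conjunct2,
        rule_format, of 2 p c] by (simp add: cstar_le_def)
  then show ?thesis
    by (simp add: c_def p_def numeral_2_eq_2 algebra_simps)
qed

text \<open>
  The coefficients are \<open>d\<close> at \<open>s\<close> and \<open>- u y / Q\<close> at \<open>t\<close>, where \<open>u = 1/2 + v\<close>, \<open>y = L t s * d\<close> and \<open>d\<close> is the
  difference to be proved positive, divided by \<open>Q\<close>. The terms that involve \<open>u\<close> add up to
  \<open>- y\<^sup>\<star> (2 u - w u\<^sup>2) y / Q = - y\<^sup>\<star> y / Q\<close>, which leaves \<open>d * d * d\<close>.
\<close>

lemma positive_definite_schur_complement:
  assumes L: "positive_definite_kernel S L" and st: "s \<in> S" "t \<in> S" and Q: "norm (L t t) < Q"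
  shows "cstar_positive (Q *\<^sub>R L s s - L s t * L t s)"
proof -
  have Q0: "0 < Q"
    using Q norm_ge_zero[of "L t t"] by linarith
  have adj_L: "(L s s)\<^sup>\<star> = L s s" "(L t t)\<^sup>\<star> = L t t" "(L t s)\<^sup>\<star> = L s t" "(L s t)\<^sup>\<star> = L t s"
    using L st by (auto simp: positive_definite_kernel_def hermitian_kernel_def)
  define w where "w = (1 / Q) *\<^sub>R L t t"
  have w: "w\<^sup>\<star> = w" "norm w < 1"
    using Q Q0 by (auto simp: w_def adj_scaleR adj_L)
  have Lw: "L t t = Q *\<^sub>R w"
    using Q0 by (simp add: w_def)
  obtain v where v: "v\<^sup>\<star> = v" "v * w = w * v" "2 *\<^sub>R v = (1/4) *\<^sub>R w + w * v + w * (v * v)"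
    using exists_square_root_solution[OF w] by blast
  define d where "d = L s s - (1 / Q) *\<^sub>R (L s t * L t s)"
  have d: "d\<^sup>\<star> = d"
    by (simp add: d_def adj_simps adj_L)
  define y where "y = L t s * d"
  (* The product u y with u = 1/2 + v, written without the unit. *)
  define uy where "uy = (1/2) *\<^sub>R y + v * y"
  define b where "b = - ((1 / Q) *\<^sub>R uy)"
  have y: "y\<^sup>\<star> = d * L s t"
    by (simp add: y_def adj_simps adj_L d)
  have "uy\<^sup>\<star> * w * uy = y\<^sup>\<star> * ((1/4) *\<^sub>R w + w * v + w * (v * v)) * y"
  proof -
    have "v * (w * z) = w * (v * z)" for z
      using v(2) by (metis mult.assoc)
    then show ?thesis
      by (simp add: uy_def adj_simps v(1) algebra_simps flip: scaleR_add_left)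
  qed
  also have "\<dots> = 2 *\<^sub>R (y\<^sup>\<star> * v * y)"
    by (simp flip: v(3))
  finally have quad: "uy\<^sup>\<star> * w * uy = 2 *\<^sub>R (y\<^sup>\<star> * v * y)" .
  have cross: "y\<^sup>\<star> * uy + uy\<^sup>\<star> * y = y\<^sup>\<star> * y + 2 *\<^sub>R (y\<^sup>\<star> * v * y)"
    by (simp add: uy_def adj_simps v(1) algebra_simps scaleR_2 flip: scaleR_add_left)
  have "d\<^sup>\<star> * L s s * d + d\<^sup>\<star> * L s t * b + b\<^sup>\<star> * L t s * d + b\<^sup>\<star> * L t t * b
      = d * L s s * d - (1 / Q) *\<^sub>R (y\<^sup>\<star> * uy + uy\<^sup>\<star> * y) + (1 / Q) *\<^sub>R (uy\<^sup>\<star> * w * uy)"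
    using Q0 by (simp add: b_def adj_simps d y Lw y_def[symmetric] mult.assoc algebra_simps)
  also have "\<dots> = d * L s s * d - (1 / Q) *\<^sub>R (y\<^sup>\<star> * y)"
    unfolding quad cross by (simp add: algebra_simps)
  also have "\<dots> = d * d * d"
    unfolding y by (subst (5) d_def) (simp add: y_def algebra_simps)
  finally have "cstar_positive (d * d * d)"
    using positive_definite_two_points[OF L st, of d b] by simp
  then have "cstar_positive (Q *\<^sub>R d)"
    using cstar_positive_if_cube[OF d] cstar_positive_scaleR Q0 by blast
  then show ?thesis
    using Q0 by (simp add: d_def scaleR_diff_right)
qed

section \<open>The two kernel inequalities\<close>

theorem proposition2p10:
  fixes S :: "'s set"
  assumes "S \<noteq> {}"
  shows "(\<forall>K :: 's \<Rightarrow> 's \<Rightarrow> 'a::cstar_algebra. conditionally_positive_definite_kernel S K \<longrightarrow>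
            (\<forall>s\<in>S. \<forall>t\<in>S. 2 *\<^sub>R cstar_Re (K s t) \<preceq> K s s + K t t)) \<and>
         (\<forall>L :: 's \<Rightarrow> 's \<Rightarrow> 'a. positive_definite_kernel S L \<longrightarrow>
            (\<forall>s\<in>S. \<forall>t\<in>S. L s t * L t s \<preceq> norm (L t t) *\<^sub>R L s s))"
proof (intro conjI allI impI ballI)
  fix K :: "'s \<Rightarrow> 's \<Rightarrow> 'a" and s t
  assume K: "conditionally_positive_definite_kernel S K" and st: "s \<in> S" "t \<in> S"
  have adj_K: "(K s s)\<^sup>\<star> = K s s" "(K t t)\<^sup>\<star> = K t t" "(K t s)\<^sup>\<star> = K s t" "(K s t)\<^sup>\<star> = K t s"
    using K st by (auto simp: conditionally_positive_definite_kernel_def hermitian_kernel_def)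
  define b where "b = K s s + K t t - (K s t + K t s)"
  have b: "b\<^sup>\<star> = b"
    by (simp add: b_def adj_simps adj_K add.commute)
  have "cstar_positive (b * b * b)"
    using conditionally_positive_definite_two_points[OF K st, of b] b by (simp flip: b_def)
  then have "cstar_positive b"
    by (rule cstar_positive_if_cube[OF b])
  then show "2 *\<^sub>R cstar_Re (K s t) \<preceq> K s s + K t t"
    by (simp add: cstar_le_def cstar_Re_def b_def adj_K)
next
  fix L :: "'s \<Rightarrow> 's \<Rightarrow> 'a" and s t
  assume L: "positive_definite_kernel S L" and st: "s \<in> S" "t \<in> S"
  let ?b = "norm (L t t) *\<^sub>R L s s - L s t * L t s"
  have "?b\<^sup>\<star> = ?b"
    using L st by (simp add: positive_definite_kernel_def hermitian_kernel_def adj_simps)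
  (* Replacing norm (L t t) by the larger norm (L t t) + \<eta> costs \<eta> * norm (L s s) in norm. *)
  moreover have "\<exists>c. cstar_positive c \<and> norm (?b - c) \<le> \<epsilon>" if "0 < \<epsilon>" for \<epsilon>
  proof -
    define \<eta> where "\<eta> = \<epsilon> / (norm (L s s) + 1)"
    have den: "0 < norm (L s s) + 1"
      by (simp add: add_nonneg_pos)
    then have \<eta>: "0 < \<eta>"
      using that by (simp add: \<eta>_def)
    have "?b - ((norm (L t t) + \<eta>) *\<^sub>R L s s - L s t * L t s) = - (\<eta> *\<^sub>R L s s)"
      by (simp add: scaleR_add_left)
    then have "norm (?b - ((norm (L t t) + \<eta>) *\<^sub>R L s s - L s t * L t s)) = \<eta> * norm (L s s)"
      using \<eta> by simp
    also have "\<dots> \<le> \<eta> * (norm (L s s) + 1)"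
      using \<eta> by (intro mult_left_mono) auto
    also have "\<dots> = \<epsilon>"
      using den by (simp add: \<eta>_def)
    finally show ?thesis
      using positive_definite_schur_complement[OF L st, of "norm (L t t) + \<eta>"] \<eta> by auto
  qed
  ultimately show "L s t * L t s \<preceq> norm (L t t) *\<^sub>R L s s"
    unfolding cstar_le_def by (rule cstar_positive_closed)
qed

end
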